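(* For all $n$ sufficiently large, there exists a tree $T$ of order $n$ with $\operatorname{th}_c(T) > 1.4502\sqrt{n}$.
   Context: Graphs are finite, simple and undirected; the order of a graph is its number of vertices. In the cop versus robber game on a graph $G$, a team of cops choose their initial positions at vertices of $G$, followed by the robber (positions are visible to both sides). Multiple cops may occupy the same vertex. In each round, every cop may stay at their current vertex or move to a neighboring vertex, and then the robber may stay or move to a neighboring vertex. The cops try to occupy the same vertex as the robber (capture), while the robber tries to avoid being captured. For a positive integer $k$, $\operatorname{capt}_k(G)$ is the number of rounds needed for $k$ cops to capture the robber on $G$ if the cops and robber play optimally ($\infty$ if $k$ cops cannot guarantee capture). The throttling number is $\operatorname{th}_c(G) = \min_k (k + \operatorname{capt}_k(G))$ over all positive integers $k$. *)

theory Defs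
  imports
    "HOL-Library.Extended_Real"
    "Graph_Theory.Graph_Theory"
begin

text \<open>
  Finite simple undirected graphs are the symmetric loop-free digraphs of \<^locale>\<open>pair_graph\<close>.
\<close>

text \<open>
  In a symmetric digraph \<^const>\<open>pre_digraph.cycle\<close> also holds of the walk \<open>a, b, a\<close> along a single
  edge, so the library's \<^const>\<open>Digraph_Component.tree\<close> admits no edges here.  The undirected
  cycles are the cycles of length at least 3.
\<close>

definition tree_graph :: "'a pair_pre_digraph \<Rightarrow> bool" where
  "tree_graph G \<longleftrightarrow>
     pair_graph G \<and> Digraph_Component.connected (with_proj G) \<and>
     \<not> (\<exists>p. pre_digraph.cycle (with_proj G) p \<and> 3 \<le> length p)"

definition order :: "'a pair_pre_digraph \<Rightarrow> nat" where
  "order G = card (pverts G)"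

definition move :: "'a pair_pre_digraph \<Rightarrow> 'a \<Rightarrow> 'a \<Rightarrow> bool" where
  "move G u v \<longleftrightarrow> u = v \<or> (u, v) \<in> parcs G"

text \<open>
  \<open>cops_win G t C r\<close>: with the cops at \<open>C\<close> (one list entry per cop), the robber at \<open>r\<close> and the
  cops to move, the cops can force a capture within \<open>t\<close> rounds, whatever the robber does.
  A round in which the cops' own move captures counts as a full round, and so does one in which the
  robber moves onto a cop.
\<close>

primrec cops_win :: "'a pair_pre_digraph \<Rightarrow> nat \<Rightarrow> 'a list \<Rightarrow> 'a \<Rightarrow> bool" where
  "cops_win G 0 C r \<longleftrightarrow> r \<in> set C"
| "cops_win G (Suc t) C r \<longleftrightarrow>
     r \<in> set C \<or>
     (\<exists>C'. list_all2 (move G) C C' \<and>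
        (r \<in> set C' \<or> (\<forall>r'. move G r r' \<longrightarrow> cops_win G t C' r')))"

text \<open>
  The infimum of the empty set of \<^typ>\<open>enat\<close> is \<open>\<infinity>\<close>, the value when \<open>k\<close> cops cannot guarantee
  capture; every nonempty infimum is attained.
\<close>

definition capt :: "nat \<Rightarrow> 'a pair_pre_digraph \<Rightarrow> enat" where
  "capt k G = Inf {enat t | t. \<exists>C. length C = k \<and> set C \<subseteq> pverts G \<and>
                                 (\<forall>r\<in>pverts G. cops_win G t C r)}"

definition throttling :: "'a pair_pre_digraph \<Rightarrow> enat" where
  "throttling G = (INF k\<in>{1..}. enat k + capt k G)"

end

theory Submission
  imports Defs
begin

text \<open>
  A robber who never moves is caught within \<open>t\<close> rounds only if some cop starts at distance at most
  \<open>t\<close> from him.  So \<open>k\<close> cops who win within \<open>t\<close> rounds give \<open>k\<close> balls of radius \<open>t\<close> that cover the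
  graph.  Consider a spider, that is, a number of paths (legs) attached to a common centre.  A cop
  standing outside a leg covers at most the \<open>t\<close> vertices of that leg nearest to the centre, and a cop
  standing in the leg covers at most \<open>2 * t + 1\<close> of its vertices.  A leg of \<open>l\<close> vertices therefore
  contains at least \<open>\<lceil>(l - t) / (2 * t + 1)\<rceil> = (l + t) div (2 * t + 1)\<close> cops.  Since the legs are
  disjoint, these numbers add up (\<open>cops_needed_on_spider\<close>).

  A long path would only give the constant \<open>\<surd>2\<close>.  The gain comes from the rounding up: on a leg
  that is a little longer than \<open>t\<close>, a whole cop is spent on the few vertices that the cops outside it
  cannot reach.  To have this waste for every \<open>t\<close>, the leg lengths are spread out.  The spider has \<open>q\<close>
  legs of each of the lengths \<open>5 * q\<close>, \<open>6 * q\<close>, \<open>7 * q\<close>, \<open>8 * q\<close>, \<open>9 * q\<close> and \<open>12 * q\<close>, and thus about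
  \<open>47 * q\<^sup>2\<close> vertices.  When \<open>t\<close> lies between \<open>4 * q\<close> and \<open>10 * q\<close>, lowering it by about \<open>q\<close> brings a
  further \<open>q\<close> legs out of the reach of the centre, and each of them costs a cop; for smaller \<open>t\<close> the
  longer legs need two cops each.  Hence \<open>k + t \<ge> 10 * q\<close> for all \<open>t\<close>
  (\<open>ten_le_cops_plus_time\<close>), and the resulting constant is \<open>10 / \<surd>47 \<approx> 1.4586\<close>.  For an order \<open>n\<close>
  that is not of the form \<open>1 + 47 * q\<^sup>2\<close>, one takes the largest \<open>q\<close> with \<open>1 + 47 * q\<^sup>2 \<le> n\<close> and puts the
  remaining vertices on one extra leg; the margin between \<open>1.4586\<close> and \<open>1.4502\<close> absorbs the loss.
\<close>

section \<open>Lower bounds for the throttling number\<close>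

lemma throttling_ge:
  assumes "\<And>t C. set C \<subseteq> pverts G \<Longrightarrow> \<forall>r\<in>pverts G. cops_win G t C r \<Longrightarrow>
             b \<le> length C + t"
  shows "enat b \<le> throttling G"
  unfolding throttling_def
proof (rule INF_greatest)
  fix k :: nat
  have "enat (b - k) \<le> capt k G"
    unfolding capt_def
  proof (rule Inf_greatest)
    fix x
    assume "x \<in> {enat t | t. \<exists>C. length C = k \<and> set C \<subseteq> pverts G \<and>
                                (\<forall>r\<in>pverts G. cops_win G t C r)}"
    then obtain t C where x: "x = enat t" and C: "length C = k" "set C \<subseteq> pverts G"
        "\<forall>r\<in>pverts G. cops_win G t C r"
      by blast
    from assms[OF C(2,3)] C(1) show "enat (b - k) \<le> x" by (simp add: x)
  qed
  then have "enat k + enat (b - k) \<le> enat k + capt k G"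
    by (rule add_left_mono)
  moreover have "enat b \<le> enat k + enat (b - k)" by simp
  ultimately show "enat b \<le> enat k + capt k G"
    by (rule order_trans[rotated])
qed

text \<open>
  A stationary robber must be reached by a cop in at most \<open>t\<close> moves, and no move changes a
  1-Lipschitz function \<open>f\<close> by more than 1.  Distances in the graph enter the argument only through
  such functions.
\<close>

lemma cop_within_reach:
  fixes f :: "'a \<Rightarrow> nat"
  assumes lip: "\<And>u v. move G u v \<Longrightarrow> f u \<le> f v + 1 \<and> f v \<le> f u + 1"
    and win: "cops_win G t C r"
  shows "\<exists>c\<in>set C. f r \<le> f c + t \<and> f c \<le> f r + t"
  using win
proof (induction t arbitrary: C)
  case 0
  then show ?case by auto
next
  case (Suc t)
  show ?case
  proof (cases "r \<in> set C")
    case True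
    then show ?thesis by (intro bexI[of _ r]) auto
  next
    case False
    with Suc.prems obtain C' where C': "list_all2 (move G) C C'"
      and "r \<in> set C' \<or> (\<forall>r'. move G r r' \<longrightarrow> cops_win G t C' r')"
      by auto
    \<comment> \<open>Staying put is one of the replies open to the robber.\<close>
    then have "r \<in> set C' \<or> cops_win G t C' r"
      by (auto simp: move_def)
    then obtain c' where c': "c' \<in> set C'" "f r \<le> f c' + t" "f c' \<le> f r + t"
      using Suc.IH[of C'] by fastforce
    then obtain i where i: "i < length C'" "c' = C' ! i"
      by (auto simp: in_set_conv_nth)
    with C' have len: "i < length C" and mv: "move G (C ! i) c'"
      by (auto simp: list_all2_conv_all_nth)
    from len have "C ! i \<in> set C" by simp
    with lip[OF mv] c' show ?thesis by (intro bexI[of _ "C ! i"]) auto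
  qed
qed

text \<open>
  Think of \<open>f\<close> as the position along a leg of \<open>l\<close> vertices that starts next to the centre, with the
  value \<open>0\<close> everywhere outside the leg.  Positions above \<open>t\<close> are out of reach for the cops with
  \<open>f c = 0\<close>, so the others must cover all \<open>l - t\<close> of them, and each covers an interval of at most
  \<open>2 * t + 1\<close> positions.
\<close>

lemma cops_needed_on_leg:
  fixes f :: "'a \<Rightarrow> nat"
  assumes lip: "\<And>u v. move G u v \<Longrightarrow> f u \<le> f v + 1 \<and> f v \<le> f u + 1"
    and onto: "{1..l} \<subseteq> f ` pverts G"
    and win: "\<forall>r\<in>pverts G. cops_win G t C r"
  shows "(l + t) div (2 * t + 1) \<le> length (filter (\<lambda>c. 0 < f c) C)"
proof -
  let ?D = "filter (\<lambda>c. 0 < f c) C"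
  have "{t + 1..l} \<subseteq> (\<Union>c\<in>set ?D. {f c - t..f c + t})"
  proof
    fix d assume d: "d \<in> {t + 1..l}"
    then have "d \<in> {1..l}" by auto
    with onto obtain r where r: "r \<in> pverts G" "f r = d" by auto
    with win have "cops_win G t C r" by blast
    with cop_within_reach[of G f t C r] lip r(2)
    obtain c where "c \<in> set C" "d \<le> f c + t" "f c \<le> d + t" by blast
    with d show "d \<in> (\<Union>c\<in>set ?D. {f c - t..f c + t})"
      by (intro UN_I[of c]) auto
  qed
  then have "card {t + 1..l} \<le> card (\<Union>c\<in>set ?D. {f c - t..f c + t})"
    by (intro card_mono) auto
  also have "\<dots> \<le> (\<Sum>c\<in>set ?D. card {f c - t..f c + t})"
    by (rule card_UN_le) simp
  also have "\<dots> \<le> (\<Sum>c\<in>set ?D. 2 * t + 1)"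
    by (rule sum_mono) auto
  also have "\<dots> = card (set ?D) * (2 * t + 1)" by simp
  also have "\<dots> \<le> length ?D * (2 * t + 1)"
    by (rule mult_le_mono1) (rule card_length)
  finally have "l + t < Suc (length ?D) * (2 * t + 1)" by simp
  then have "(l + t) div (2 * t + 1) < Suc (length ?D)"
    by (rule less_mult_imp_div_less)
  then show ?thesis by simp
qed

section \<open>Trees given by a parent function\<close>

definition parent_graph :: "nat \<Rightarrow> (nat \<Rightarrow> nat) \<Rightarrow> nat pair_pre_digraph" where
  "parent_graph n par =
     \<lparr> pverts = {..<n},
       parcs = {(u, v). u < n \<and> v < n \<and> (0 < u \<and> v = par u \<or> 0 < v \<and> u = par v)} \<rparr>"

lemma pcas_last: "pcas u p v \<Longrightarrow> p \<noteq> [] \<Longrightarrow> snd (last p) = v"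
  by (induction p arbitrary: u) auto

lemma pcas_nth_Suc: "pcas u p v \<Longrightarrow> Suc i < length p \<Longrightarrow> fst (p ! Suc i) = snd (p ! i)"
proof (induction p arbitrary: u i)
  case (Cons e p)
  then show ?case by (cases i; cases p) auto
qed simp

text \<open>Reading a closed walk cyclically removes the exception at its first arc.\<close>

lemma closed_pcas_nth:
  assumes "pcas u p u" "p \<noteq> []"
  shows "fst (p ! (Suc i mod length p)) = snd (p ! (i mod length p))"
proof (cases "Suc (i mod length p) = length p")
  case True
  from assms have "fst (p ! 0) = u" by (cases p) auto
  moreover from True have "p ! (i mod length p) = last p"
    using assms(2) by (metis diff_Suc_1 last_conv_nth)
  ultimately show ?thesis
    using True pcas_last[OF assms] by (simp add: mod_Suc)
next
  case False
  moreover have "i mod length p < length p" using assms(2) by simp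
  ultimately have "Suc (i mod length p) < length p" by linarith
  with False show ?thesis using pcas_nth_Suc[OF assms(1)] by (simp add: mod_Suc)
qed

lemma tl_pawalk_verts: "tl (pawalk_verts u p) = map snd p" if "pcas u p v"
proof -
  have "pawalk_verts u p = u # map snd p"
    using that by (induction p arbitrary: u) auto
  then show ?thesis by simp
qed

text \<open>
  Descending along parents leads to \<open>0\<close>, so the graph is connected.  On a cycle, the largest
  vertex would have a smaller predecessor and a smaller successor; both are its parent, whereas
  on a cycle of length at least 3 they are distinct.
\<close>

lemma tree_graph_parent_graph:
  assumes n: "0 < n" and par: "\<And>v. 0 < v \<Longrightarrow> par v < v"
  shows "tree_graph (parent_graph n par)"
proof -
  let ?G = "parent_graph n par"
  have fin: "finite (parcs ?G)"
    by (rule finite_subset[of _ "{..<n} \<times> {..<n}"]) (auto simp: parent_graph_def)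
  have graph: "pair_graph ?G"
  proof
    show "symmetric (with_proj ?G)"
      by (auto simp: symmetric_def parent_graph_def intro: symI)
    fix e assume "e \<in> parcs ?G"
    then show "fst e \<noteq> snd e"
      using par[of "fst e"] par[of "snd e"] by (cases e) (auto simp: parent_graph_def)
  qed (use fin in \<open>auto simp: parent_graph_def\<close>)
  interpret pair_graph ?G by (rule graph)
  have conn: "connected (with_proj ?G)"
  proof -
    define H where "H = with_proj (mk_symmetric (with_proj ?G))"
    have verts: "verts H = {..<n}"
      by (simp add: H_def mk_symmetric_def parent_graph_def)
    have arcs: "arcs_ends H = parcs ?G"
      by (auto simp: H_def mk_symmetric_def parent_graph_def)
    interpret H: wf_digraph H
      by (auto simp: H_def wf_digraph_wp_iff pair_wf_digraph_def mk_symmetric_def parent_graph_def)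
    have root: "v \<rightarrow>\<^sup>*\<^bsub>H\<^esub> 0 \<and> 0 \<rightarrow>\<^sup>*\<^bsub>H\<^esub> v" if "v < n" for v
      using that
    proof (induction v rule: less_induct)
      case (less v)
      show ?case
      proof (cases "v = 0")
        case True
        then show ?thesis using n by (simp add: verts)
      next
        case False
        then have "par v < v" using par by simp
        then have "v \<rightarrow>\<^bsub>H\<^esub> par v" "par v \<rightarrow>\<^bsub>H\<^esub> v"
          using less.prems False by (auto simp: arcs parent_graph_def)
        then show ?thesis
          using less.IH[OF \<open>par v < v\<close>] less.prems \<open>par v < v\<close>
          by (meson H.adj_reachable_trans H.reachable_adj_trans order_less_trans)
      qed
    qed
    have "strongly_connected H"
    proof (rule strongly_connectedI)
      show "verts H \<noteq> {}" using n by (auto simp: verts)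
      fix u v assume "u \<in> verts H" "v \<in> verts H"
      then have "u \<rightarrow>\<^sup>*\<^bsub>H\<^esub> 0" "0 \<rightarrow>\<^sup>*\<^bsub>H\<^esub> v" using root by (simp_all add: verts)
      then show "u \<rightarrow>\<^sup>*\<^bsub>H\<^esub> v" by (rule H.reachable_trans)
    qed
    then show ?thesis by (simp add: connected_def H_def)
  qed
  have acyclic: False if cyc: "cycle p" and len: "3 \<le> length p" for p
  proof -
    let ?L = "length p"
    from cyc obtain u where u: "pcas u p u" and arcs: "set p \<subseteq> parcs ?G"
      and dist: "distinct (map snd p)" and ne: "p \<noteq> []"
      by (auto simp: cycle_def awalk_def tl_pawalk_verts)
    define x where "x i = snd (p ! (i mod ?L))" for i
    have arc: "(x i, x (Suc i)) \<in> parcs ?G" for i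
    proof -
      have "p ! (Suc i mod ?L) = (x i, x (Suc i))"
        using closed_pcas_nth[OF u ne, of i] by (simp add: x_def prod_eq_iff)
      moreover have "p ! (Suc i mod ?L) \<in> set p" using ne by simp
      ultimately show ?thesis using arcs by auto
    qed
    have "finite (range x)"
      by (rule finite_subset[of _ "snd ` set p"]) (use ne in \<open>auto simp: x_def\<close>)
    then obtain i where "x i = Max (range x)"
      using Max_in[of "range x"] by (metis UNIV_not_empty image_iff image_is_empty)
    then have top: "x j \<le> x i" for j
      using \<open>finite (range x)\<close> by simp
    have per: "x (k + ?L) = x k" for k by (simp add: x_def)
    \<comment> \<open>\<open>j\<close> is \<open>i - 1\<close> modulo the length of the cycle.\<close>
    define j where "j = i + (?L - 1)"
    have j: "Suc j = i + ?L" using len by (simp add: j_def)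
    have "(x j, x i) \<in> parcs ?G" "(x i, x (Suc i)) \<in> parcs ?G"
      using arc[of j] arc[of i] per[of i] by (simp_all add: j)
    then have "x j = par (x i)" "x (Suc i) = par (x i)"
      using top[of j] top[of "Suc i"] par[of "x j"] par[of "x (Suc i)"]
      by (auto simp: parent_graph_def)
    then have "x j = x (Suc i)" by simp
    then have "map snd p ! (j mod ?L) = map snd p ! (Suc i mod ?L)"
      using ne by (simp add: x_def)
    then have "j mod ?L = Suc i mod ?L"
      using dist ne by (subst (asm) nth_eq_iff_index_eq) auto
    then have "Suc j mod ?L = Suc (Suc i) mod ?L"
      by (metis mod_Suc_eq)
    then have "i mod ?L = (i + 2) mod ?L" by (simp add: j)
    then have "?L dvd 2"
      using mod_eq_dvd_iff_nat[of i "i + 2" ?L] by simp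
    then show False using len by (auto dest: dvd_imp_le)
  qed
  show ?thesis
    unfolding tree_graph_def using graph conn acyclic by blast
qed

section \<open>Spiders\<close>

text \<open>
  Vertex \<open>0\<close> is the centre, and the legs occupy consecutive blocks of numbers, each numbered
  outwards from the centre.
\<close>

definition leg_start :: "nat list \<Rightarrow> nat \<Rightarrow> nat" where
  "leg_start ls i = 1 + sum_list (take i ls)"

definition spider :: "nat list \<Rightarrow> nat pair_pre_digraph" where
  "spider ls = parent_graph (1 + sum_list ls)
     (\<lambda>v. if v \<in> leg_start ls ` {..<length ls} then 0 else v - 1)"

text \<open>
  This is the distance from the centre on leg \<open>i\<close>, and \<open>0\<close> off the leg: the distance to the centre
  after all other legs have been contracted into it.
\<close>

definition depth_in_leg :: "nat list \<Rightarrow> nat \<Rightarrow> nat \<Rightarrow> nat" where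
  "depth_in_leg ls i v =
     (if leg_start ls i \<le> v \<and> v < leg_start ls (Suc i) then v + 1 - leg_start ls i else 0)"

lemma tree_graph_spider: "tree_graph (spider ls)"
  unfolding spider_def by (rule tree_graph_parent_graph) auto

lemma pverts_spider: "pverts (spider ls) = {..<1 + sum_list ls}"
  by (simp add: spider_def parent_graph_def)

lemma leg_start_Suc: "i < length ls \<Longrightarrow> leg_start ls (Suc i) = leg_start ls i + ls ! i"
  by (simp add: leg_start_def take_Suc_conv_app_nth)

lemma leg_start_mono: "i \<le> j \<Longrightarrow> leg_start ls i \<le> leg_start ls j"
proof (induction j rule: dec_induct)
  case (step j)
  have "leg_start ls j \<le> leg_start ls (Suc j)"
  proof (cases "j < length ls")
    case True
    then show ?thesis by (simp add: leg_start_Suc)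
  next
    case False
    then show ?thesis by (simp add: leg_start_def)
  qed
  with step.IH show ?case by (rule order_trans)
qed simp

lemma leg_start_length: "leg_start ls (length ls) = 1 + sum_list ls"
  by (simp add: leg_start_def)

text \<open>
  An edge joins a vertex to its parent.  At the first vertex of any leg the depth is at most \<open>1\<close> and
  the parent has depth \<open>0\<close>.  Any other vertex lies in the same leg as its predecessor \<open>v - 1\<close>, which
  is its parent.
\<close>

lemma depth_in_leg_lipschitz:
  assumes i: "i < length ls" and mv: "move (spider ls) u v"
  shows "depth_in_leg ls i u \<le> depth_in_leg ls i v + 1 \<and>
         depth_in_leg ls i v \<le> depth_in_leg ls i u + 1"
proof -
  let ?S = "leg_start ls ` {..<length ls}" and ?d = "depth_in_leg ls i"
  define par where "par v = (if v \<in> ?S then 0 else v - 1)" for v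
  have pos: "0 < leg_start ls i" by (simp add: leg_start_def)
  have si: "leg_start ls i \<in> ?S" using i by auto
  have se: "leg_start ls (Suc i) \<in> ?S \<or> leg_start ls (Suc i) = 1 + sum_list ls"
    using i leg_start_length[of ls] by (cases "Suc i = length ls") auto
  have par: "?d v \<le> ?d (par v) + 1 \<and> ?d (par v) \<le> ?d v + 1" if "0 < v" "v < 1 + sum_list ls" for v
  proof (cases "v \<in> ?S")
    case True
    have "?d v \<le> 1"
    proof (rule ccontr)
      assume "\<not> ?d v \<le> 1"
      then have less: "leg_start ls i < v" "v < leg_start ls (Suc i)"
        by (auto simp: depth_in_leg_def split: if_splits)
      from True obtain j where j: "v = leg_start ls j" by auto
      show False
        using less leg_start_mono[of j i ls] leg_start_mono[of "Suc i" j ls] j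
        by (cases "j \<le> i") auto
    qed
    moreover have "?d 0 = 0" using pos by (simp add: depth_in_leg_def)
    ultimately show ?thesis using True by (simp add: par_def)
  next
    case False
    then have "v \<noteq> leg_start ls i" "v \<noteq> leg_start ls (Suc i)"
      using si se that by auto
    with False that show ?thesis
      by (auto simp: par_def depth_in_leg_def)
  qed
  from mv have "u = v \<or> u < 1 + sum_list ls \<and> v < 1 + sum_list ls \<and>
      (0 < u \<and> v = par u \<or> 0 < v \<and> u = par v)"
    by (auto simp: move_def spider_def parent_graph_def par_def)
  then show ?thesis using par by auto
qed

lemma depth_in_leg_onto:
  assumes i: "i < length ls"
  shows "{1..ls ! i} \<subseteq> depth_in_leg ls i ` pverts (spider ls)"
proof
  fix d assume d: "d \<in> {1..ls ! i}"
  let ?v = "leg_start ls i + d - 1"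
  have "?v < leg_start ls (Suc i)"
    using d leg_start_Suc[OF i] by auto
  moreover have "leg_start ls (Suc i) \<le> 1 + sum_list ls"
    using leg_start_mono[of "Suc i" "length ls" ls] i by (simp add: leg_start_length)
  ultimately have "?v \<in> pverts (spider ls)" "depth_in_leg ls i ?v = d"
    using d by (auto simp: pverts_spider depth_in_leg_def)
  then show "d \<in> depth_in_leg ls i ` pverts (spider ls)"
    by (metis imageI)
qed

lemma depth_in_leg_unique:
  assumes "0 < depth_in_leg ls i v" "0 < depth_in_leg ls j v"
  shows "i = j"
proof (rule ccontr)
  assume "i \<noteq> j"
  then have "Suc i \<le> j \<or> Suc j \<le> i" by linarith
  with assms show False
    using leg_start_mono[of "Suc i" j ls] leg_start_mono[of "Suc j" i ls]
    by (auto simp: depth_in_leg_def split: if_splits)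
qed

lemma sum_filter_disjoint_le_length:
  assumes fin: "finite I" and disj: "\<And>i j c. P i c \<Longrightarrow> P j c \<Longrightarrow> i = j"
  shows "(\<Sum>i\<in>I. length (filter (P i) C)) \<le> length C"
proof (induction C)
  case (Cons c C)
  have "(\<Sum>i\<in>I. if P i c then 1 else 0) = card {i \<in> I. P i c}"
    using fin by (simp flip: sum.inter_filter)
  also have "\<dots> \<le> 1"
    using disj fin by (simp add: card_le_Suc0_iff_eq) blast
  finally have one: "(\<Sum>i\<in>I. if P i c then 1 else 0) \<le> (1::nat)" .
  have "(\<Sum>i\<in>I. length (filter (P i) (c # C))) =
      (\<Sum>i\<in>I. (if P i c then 1 else 0) + length (filter (P i) C))"
    by (intro sum.cong) auto
  also have "\<dots> = (\<Sum>i\<in>I. if P i c then 1 else 0) + (\<Sum>i\<in>I. length (filter (P i) C))"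
    by (rule sum.distrib)
  finally show ?case using one Cons.IH by simp
qed simp

lemma cops_needed_on_spider:
  assumes win: "\<forall>r\<in>pverts (spider ls). cops_win (spider ls) t C r"
  shows "(\<Sum>l\<leftarrow>ls. (l + t) div (2 * t + 1)) \<le> length C"
proof -
  have "(\<Sum>l\<leftarrow>ls. (l + t) div (2 * t + 1)) = (\<Sum>i<length ls. (ls ! i + t) div (2 * t + 1))"
    by (simp add: sum_list_sum_nth atLeast0LessThan)
  also have "\<dots> \<le> (\<Sum>i<length ls. length (filter (\<lambda>c. 0 < depth_in_leg ls i c) C))"
    by (intro sum_mono cops_needed_on_leg[OF depth_in_leg_lipschitz depth_in_leg_onto win]) auto
  also have "\<dots> \<le> length C"
    by (rule sum_filter_disjoint_le_length) (auto intro: depth_in_leg_unique)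
  finally show ?thesis .
qed

section \<open>The choice of the legs\<close>

lemma one_le_cops_on_leg: "1 \<le> (l + t) div (2 * t + 1)" if "t < l" for l t :: nat
  using that by (simp add: Suc_le_eq div_greater_zero_iff)

lemma two_le_cops_on_leg: "2 \<le> (l + t) div (2 * t + 1)" if "3 * t + 2 \<le> l" for l t :: nat
  using that by (simp add: less_eq_div_iff_mult_less_eq)

text \<open>
  The number of cops forced per group of \<open>q\<close> legs is a decreasing step function of \<open>t\<close>.  It
  therefore suffices to show, for \<open>t\<close> between consecutive multiples \<open>j * q\<close> and \<open>(j + 1) * q\<close>
  with \<open>2 \<le> j \<le> 9\<close>, that the six groups force at least \<open>10 - j\<close> cops in total per unit of \<open>q\<close>, and
  at least \<open>10\<close> when \<open>t < 2 * q\<close>.  A leg of length \<open>a * q\<close> forces one cop when \<open>t < a * q\<close> and two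
  cops when \<open>3 * t + 2 \<le> a * q\<close>; the second threshold is met by the lengths \<open>12 * q\<close>, \<open>9 * q\<close>, \<open>6 * q\<close>
  as soon as \<open>t\<close> is below \<open>4 * q\<close>, \<open>3 * q\<close>, \<open>2 * q\<close>, respectively.
\<close>

lemma ten_le_cops_plus_time:
  fixes q t :: nat
  shows "10 * q \<le> q * (\<Sum>a\<leftarrow>[5, 6, 7, 8, 9, 12]. (a * q + t) div (2 * t + 1)) + t"
proof -
  define need where "need a = (a * q + t) div (2 * t + 1)" for a
  have one: "1 \<le> need a" if "t < a * q" for a
    unfolding need_def by (rule one_le_cops_on_leg[OF that])
  have two: "2 \<le> need a" if "3 * t + 2 \<le> a * q" for a
    unfolding need_def by (rule two_le_cops_on_leg[OF that])
  let ?N = "\<Sum>a\<leftarrow>[5, 6, 7, 8, 9, 12]. need a"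
  have suff: ?thesis if "m \<le> ?N" "10 * q \<le> q * m + t" for m
    using that mult_le_mono2[OF that(1), of q] unfolding need_def by linarith
  consider "10 * q \<le> t" | "9 * q \<le> t" "t < 10 * q" | "8 * q \<le> t" "t < 9 * q"
    | "7 * q \<le> t" "t < 8 * q" | "6 * q \<le> t" "t < 7 * q" | "5 * q \<le> t" "t < 6 * q"
    | "4 * q \<le> t" "t < 5 * q" | "3 * q \<le> t" "t < 4 * q" | "2 * q \<le> t" "t < 3 * q"
    | "t < 2 * q"
    by linarith
  then show ?thesis
  proof cases
    case 1 then show ?thesis by simp
  next
    case 2 then show ?thesis using one[of 12] by (intro suff[of 1]) auto
  next
    case 3 then show ?thesis using one[of 9] one[of 12] by (intro suff[of 2]) auto
  next
    case 4 then show ?thesis using one[of 8] one[of 9] one[of 12] by (intro suff[of 3]) auto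
  next
    case 5 then show ?thesis using one[of 7] one[of 8] one[of 9] one[of 12]
      by (intro suff[of 4]) auto
  next
    case 6 then show ?thesis using one[of 6] one[of 7] one[of 8] one[of 9] one[of 12]
      by (intro suff[of 5]) auto
  next
    case 7 then show ?thesis using one[of 5] one[of 6] one[of 7] one[of 8] one[of 9] one[of 12]
      by (intro suff[of 6]) auto
  next
    case 8 then show ?thesis using one[of 5] one[of 6] one[of 7] one[of 8] one[of 9] two[of 12]
      by (intro suff[of 7]) auto
  next
    case 9 then show ?thesis using one[of 5] one[of 6] one[of 7] one[of 8] two[of 9] two[of 12]
      by (intro suff[of 8]) auto
  next
    case 10 then show ?thesis using two[of 6] two[of 7] two[of 8] two[of 9] two[of 12]
      by (intro suff[of 10]) auto
  qed
qed

text \<open>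
  The six lengths \<open>5, 6, 7, 8, 9, 12\<close> add up to \<open>47\<close>, so \<open>q\<close> legs of each kind have \<open>47 * q\<^sup>2\<close>
  vertices.  The leftover vertices form a last leg (possibly of length \<open>0\<close>), which can only increase
  the number of cops needed.
\<close>

lemma spider_with_large_throttling:
  assumes n: "1 + 47 * q\<^sup>2 \<le> n"
  shows "\<exists>T :: nat pair_pre_digraph. tree_graph T \<and> order T = n \<and> enat (10 * q) \<le> throttling T"
proof -
  define as :: "nat list" where "as = [5, 6, 7, 8, 9, 12]"
  let ?ls = "concat (map (\<lambda>a. replicate q (a * q)) as) @ [n - 1 - 47 * q\<^sup>2]"
  have "sum_list ?ls = n - 1"
    using n by (simp add: as_def sum_list_replicate power2_eq_square algebra_simps)
  then have "order (spider ?ls) = n"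
    using n by (simp add: order_def pverts_spider)
  moreover have "enat (10 * q) \<le> throttling (spider ?ls)"
  proof (rule throttling_ge)
    fix t C
    assume win: "\<forall>r\<in>pverts (spider ?ls). cops_win (spider ?ls) t C r"
    have "q * (\<Sum>a\<leftarrow>as. (a * q + t) div (2 * t + 1)) \<le> (\<Sum>l\<leftarrow>?ls. (l + t) div (2 * t + 1))"
      by (simp add: as_def sum_list_replicate algebra_simps del: div_mult_self1 div_mult_self2)
    also have "\<dots> \<le> length C"
      by (rule cops_needed_on_spider[OF win])
    finally show "10 * q \<le> length C + t"
      using ten_le_cops_plus_time[of q t] unfolding as_def by linarith
  qed
  ultimately show ?thesis using tree_graph_spider by blast
qed

theorem theorem4p3:
  shows "\<exists>N. \<forall>n\<ge>N. \<exists>T :: nat pair_pre_digraph.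
           tree_graph T \<and> order T = n \<and>
           ereal_of_enat (throttling T) > ereal (1.4502 * sqrt (real n))"
proof (rule exI, intro allI impI)
  fix n :: nat assume n: "1 + 47 * 200\<^sup>2 \<le> n"
  \<comment> \<open>Passing from \<open>n\<close> to the largest admissible \<open>q\<close> costs a factor \<open>(q + 1) / q \<le> 1.005\<close> once
    \<open>q \<ge> 200\<close>, and \<open>1.4502 * 1.005 * \<surd>47 < 10\<close>.\<close>
  let ?P = "\<lambda>q. 1 + 47 * q\<^sup>2 \<le> n"
  have bound: "q \<le> n" if "?P q" for q
  proof -
    have "q \<le> q\<^sup>2" by (simp add: power2_eq_square)
    with that show ?thesis by linarith
  qed
  define q where "q = Greatest ?P"
  have q: "?P q"
    unfolding q_def by (rule GreatestI_nat[of ?P 200 n, OF n bound])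
  have q_max: "q' \<le> q" if "?P q'" for q'
    unfolding q_def by (rule Greatest_le_nat[of ?P q' n, OF that bound])
  have "200 \<le> q" by (rule q_max[OF n])
  have "\<not> ?P (Suc q)" using q_max[of "Suc q"] by linarith
  then have upper: "real n \<le> 47 * (real q + 1)\<^sup>2"
  proof -
    have "n \<le> 47 * (Suc q)\<^sup>2" using \<open>\<not> ?P (Suc q)\<close> by linarith
    then have "real n \<le> real (47 * (Suc q)\<^sup>2)" by (rule of_nat_mono)
    then show ?thesis by (simp add: add.commute)
  qed
  have "1.4502 * sqrt (real n) < real (10 * q)"
  proof -
    have "(1.4502 * sqrt (real n))\<^sup>2 = 1.4502\<^sup>2 * real n"
      by (simp only: power_mult_distrib real_sqrt_pow2 of_nat_0_le_iff)
    also have "\<dots> \<le> 1.4502\<^sup>2 * (47 * (real q + 1)\<^sup>2)"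
      using upper by (intro mult_left_mono) auto
    also have "\<dots> \<le> 1.4502\<^sup>2 * (47 * (1.005 * real q)\<^sup>2)"
      using \<open>200 \<le> q\<close> by (intro mult_left_mono power_mono) auto
    also have "\<dots> < (real (10 * q))\<^sup>2"
      using \<open>200 \<le> q\<close> by (simp add: power2_eq_square)
    finally show ?thesis
      by (rule power2_less_imp_less) simp
  qed
  then have less: "ereal (1.4502 * sqrt (real n)) < ereal (real (10 * q))"
    by (simp only: less_ereal.simps(1))
  from spider_with_large_throttling[OF q] obtain T :: "nat pair_pre_digraph"
    where T: "tree_graph T" "order T = n" "enat (10 * q) \<le> throttling T"
    by blast
  from T(3) have "ereal (real (10 * q)) \<le> ereal_of_enat (throttling T)"
    by (metis ereal_of_enat_le_iff ereal_of_enat_simps(1))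
  with less have "ereal (1.4502 * sqrt (real n)) < ereal_of_enat (throttling T)"
    by (rule order_less_le_trans)
  with T show "\<exists>T :: nat pair_pre_digraph. tree_graph T \<and> order T = n \<and>
      ereal_of_enat (throttling T) > ereal (1.4502 * sqrt (real n))"
    by blast
qed

end
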